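(* Let $R$ be a finite non-commutative ring, let $S\subseteq K$ be two non-commutative subrings of $R$, and suppose $\Pr(S,K)=\frac{p^2+p-1}{p^3}$ for some prime $p$. Then $p$ divides $|R|$. If $p$ is the smallest prime dividing $|R|$ then \[ \frac{S}{Z(S,K)}\cong \mathbb{Z}_p\times\mathbb{Z}_p. \] In particular, if $\Pr(S,K)=\frac{5}{8}$ then $\frac{S}{Z(S,K)}\cong \mathbb{Z}_2\times\mathbb{Z}_2$.
   Context: Rings are associative and need not have an identity; a subring is an additive subgroup closed under multiplication. For subrings $S,K$ of $R$, $\Pr(S,K) := \frac{|\{(s,k)\in S\times K : sk=ks\}|}{|S\times K|}$ and $Z(S,K) := \{s\in S : sk=ks \text{ for all } k\in K\}$. The quotient $S/Z(S,K)$ is the additive factor group, and $\cong$ denotes isomorphism of additive groups. *)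

theory Defs
  imports Complex_Main "HOL-Computational_Algebra.Primes" "HOL-Algebra.Elementary_Groups"
begin

text \<open>
  Rings without identity are modelled by the type class \<^class>\<open>ring\<close> (which does not require a
  unit); the rings of HOL-Algebra are unital. The additive group of a subset closed under
  addition is presented as a HOL-Algebra group, so that \<open>Mod\<close> and \<open>\<cong>\<close> are available.
\<close>

definition add_grp :: "'a::ring set \<Rightarrow> 'a monoid" where
  "add_grp S = \<lparr>carrier = S, mult = (+), one = 0\<rparr>"

definition subrng :: "'a::ring set \<Rightarrow> bool" where
  "subrng S \<longleftrightarrow> subgroup S (add_grp UNIV) \<and> (\<forall>x\<in>S. \<forall>y\<in>S. x * y \<in> S)"

definition commutative_on :: "'a::ring set \<Rightarrow> bool" where
  "commutative_on S \<longleftrightarrow> (\<forall>x\<in>S. \<forall>y\<in>S. x * y = y * x)"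

definition comm_prob :: "'a::ring set \<Rightarrow> 'a set \<Rightarrow> real" where
  "comm_prob S K = real (card {(s, k) \<in> S \<times> K. s * k = k * s}) / real (card (S \<times> K))"

definition rel_center :: "'a::ring set \<Rightarrow> 'a set \<Rightarrow> 'a set" where
  "rel_center S K = {s \<in> S. \<forall>k\<in>K. s * k = k * s}"

lemma comm_group_add_grp_UNIV: "comm_group (add_grp (UNIV :: 'a::ring set))"
proof (rule comm_groupI)
  fix x :: 'a
  show "\<exists>y\<in>carrier (add_grp UNIV). y \<otimes>\<^bsub>add_grp UNIV\<^esub> x = \<one>\<^bsub>add_grp UNIV\<^esub>"
    by (rule bexI[of _ "- x"]) (auto simp: add_grp_def)
qed (auto simp: add_grp_def algebra_simps)

lemma inv_add_grp_UNIV: "inv\<^bsub>add_grp UNIV\<^esub> x = - (x :: 'a::ring)"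
proof -
  interpret comm_group "add_grp (UNIV :: 'a set)" by (rule comm_group_add_grp_UNIV)
  show ?thesis by (rule inv_equality) (auto simp: add_grp_def)
qed

lemma subgroup_add_grp_iff:
  "subgroup S (add_grp UNIV) \<longleftrightarrow>
     0 \<in> S \<and> (\<forall>x\<in>S. \<forall>y\<in>S. x + y \<in> S) \<and> (\<forall>x\<in>S. - x \<in> (S :: 'a::ring set))"
  unfolding subgroup_def inv_add_grp_UNIV by (auto simp: add_grp_def)

lemma comm_group_add_grp:
  assumes "subrng (S :: 'a::ring set)"
  shows "comm_group (add_grp S)"
proof (rule comm_groupI)
  have cl: "0 \<in> S" "\<And>x y. x \<in> S \<Longrightarrow> y \<in> S \<Longrightarrow> x + y \<in> S" "\<And>x. x \<in> S \<Longrightarrow> - x \<in> S"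
    using assms by (auto simp: subrng_def subgroup_add_grp_iff)
  show "\<one>\<^bsub>add_grp S\<^esub> \<in> carrier (add_grp S)"
    using cl by (simp add: add_grp_def)
  fix x y
  assume x: "x \<in> carrier (add_grp S)"
  show "\<exists>y\<in>carrier (add_grp S). y \<otimes>\<^bsub>add_grp S\<^esub> x = \<one>\<^bsub>add_grp S\<^esub>"
    using x cl by (intro bexI[of _ "- x"]) (auto simp: add_grp_def)
  assume "y \<in> carrier (add_grp S)"
  then show "x \<otimes>\<^bsub>add_grp S\<^esub> y \<in> carrier (add_grp S)"
    using x cl by (simp add: add_grp_def)
qed (auto simp: add_grp_def algebra_simps)

text \<open>The relative centre is a normal subgroup, so \<open>add_grp S Mod rel_center S K\<close> is
  the additive factor group.\<close>

lemma rel_center_normal: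
  assumes "subrng (S :: 'a::ring set)"
  shows "rel_center S K \<lhd> add_grp S"
proof -
  interpret S: comm_group "add_grp S" by (rule comm_group_add_grp[OF assms])
  have cl: "0 \<in> S" "\<And>x y. x \<in> S \<Longrightarrow> y \<in> S \<Longrightarrow> x + y \<in> S" "\<And>x. x \<in> S \<Longrightarrow> - x \<in> S"
    using assms by (auto simp: subrng_def subgroup_add_grp_iff)
  have inv: "inv\<^bsub>add_grp S\<^esub> x = - x" if "x \<in> S" for x
    by (rule S.inv_equality) (use that cl in \<open>auto simp: add_grp_def\<close>)
  have "subgroup (rel_center S K) (add_grp S)"
    by (rule S.subgroupI)
       (use cl inv in \<open>auto simp: rel_center_def add_grp_def distrib_left distrib_right
          intro!: exI[of _ 0]\<close>)
  then show ?thesis by (rule S.subgroup_imp_normal)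
qed

end

theory Submission
  imports Defs "HOL-Algebra.Multiplicative_Group" "HOL-Number_Theory.Cong"
begin

text \<open>
  For \<open>s \<in> S\<close> outside \<open>Z = Z(S,K)\<close> the centralizer of \<open>s\<close> in \<open>K\<close> is a proper additive subgroup,
  of index at least the smallest prime \<open>p\<close> dividing \<open>|R|\<close>. Counting commuting pairs
  centralizer by centralizer gives \<open>Pr(S,K) \<le> 1/p + (1 - 1/p) / [S : Z]\<close>, so the hypothesis forces
  \<open>[S : Z] \<le> p\<^sup>2\<close>. Since \<open>S\<close> is non-commutative and \<open>Z\<close> is central in \<open>S\<close>, \<open>S/Z\<close> is not cyclic;
  its order has no prime factor below \<open>p\<close>, so it is \<open>p\<^sup>2\<close>.
\<close>

section \<open>Finite groups: cyclicity, and groups of order p^2\<close>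

lemma (in group) cyclic_group_if_ord_eq_order:
  assumes "finite (carrier G)" "a \<in> carrier G" "ord a = order G"
  shows "cyclic_group G"
proof -
  have "generate G {a} \<subseteq> carrier G"
    using assms(2) by (simp add: generate_incl)
  moreover have "card (generate G {a}) = card (carrier G)"
    using assms by (simp add: generate_pow_card order_def)
  ultimately have "carrier G = generate G {a}"
    using assms(1) by (metis card_subset_eq)
  then have "carrier G = range (\<lambda>n::int. a [^] n)"
    using generate_pow[OF assms(2)] by auto
  then show ?thesis
    using assms(2) cyclic_group by blast
qed

lemma (in group) cyclic_group_if_order_prime:
  assumes "prime (order G)"
  shows "cyclic_group G"
proof -
  have fin: "finite (carrier G)"
    using prime_gt_0_nat[OF assms] by (simp add: order_gt_0_iff_finite)
  have "carrier G \<noteq> {\<one>}"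
    using assms by (auto simp: order_def)
  then obtain a where a: "a \<in> carrier G" "a \<noteq> \<one>"
    by blast
  then have "ord a \<noteq> 1"
    using ord_eq_1 by blast
  then have "ord a = order G"
    using assms ord_dvd_group_order[OF a(1)] by (metis prime_nat_iff)
  then show ?thesis
    using cyclic_group_if_ord_eq_order fin a(1) by blast
qed

text \<open>Groups of order 1 or of prime order are cyclic, so the order here is a product of at
  least two primes. Each of them is at least \<open>p\<close>, which makes the order at least
  p^2.\<close>

lemma (in group) order_eq_square_if_not_cyclic:
  assumes fin: "finite (carrier G)" and "\<not> cyclic_group G" and le: "order G \<le> p\<^sup>2"
    and min: "\<And>q. prime q \<Longrightarrow> q dvd order G \<Longrightarrow> p \<le> q"
  shows "order G = p\<^sup>2"
proof -
  have "order G \<noteq> 1"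
    using assms(2) cyclic_group_if_ord_eq_order[OF fin one_closed] by auto
  then obtain q where q: "prime q" "q dvd order G"
    using prime_factor_nat by blast
  then obtain m where m: "order G = q * m"
    by blast
  have "m \<noteq> 1"
    using assms(2) cyclic_group_if_order_prime q m by auto
  then obtain r where r: "prime r" "r dvd m"
    using prime_factor_nat by blast
  have "m > 0"
    using fin m order_gt_0_iff_finite by (metis gr0I mult_0_right less_irrefl)
  then have "r \<le> m"
    using r dvd_imp_le by blast
  moreover have "p \<le> q" "p \<le> r"
    using min q r m by (auto intro: dvd_mult)
  ultimately have "p * p \<le> q * m"
    by (meson le_trans mult_le_mono)
  then show ?thesis
    using le m by (simp add: power2_eq_square)
qed

text \<open>Without a generator, every non-identity element has order \<open>p\<close>. Take such an
  \<open>x\<close> and some \<open>y\<close> outside the cyclic subgroup of \<open>x\<close>; then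
  (i, j) \<mapsto> x^i y^j is the isomorphism, read from right to left.\<close>

lemma (in comm_group) iso_integer_mod_group_square:
  assumes p: "prime (p::nat)" and ord_G: "order G = p\<^sup>2" and ncyc: "\<not> cyclic_group G"
  shows "G \<cong> integer_mod_group p \<times>\<times> integer_mod_group p"
proof -
  have p0: "p > 0" "p \<noteq> 1"
    using p prime_gt_0_nat by auto
  have fin: "finite (carrier G)"
    using ord_G p0 order_gt_0_iff_finite by simp
  have ord_eq: "ord a = p" if a: "a \<in> carrier G" "a \<noteq> \<one>" for a
  proof -
    have "ord a dvd p\<^sup>2"
      using ord_dvd_group_order[OF a(1)] ord_G by simp
    then obtain k where k: "k \<le> 2" "ord a = p ^ k"
      using divides_primepow_nat[OF p] by blast
    moreover have "k \<noteq> 0"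
      using k a ord_eq_1 by (metis power_0)
    moreover have "k \<noteq> 2"
      using k cyclic_group_if_ord_eq_order[OF fin a(1)] ord_G ncyc by auto
    ultimately have "k = 1"
      by linarith
    then show ?thesis
      using k by simp
  qed
  have "carrier G \<noteq> {\<one>}"
    using ord_G p0 by (auto simp: order_def power2_eq_square)
  then obtain x where x: "x \<in> carrier G" "x \<noteq> \<one>"
    by blast
  have "carrier G \<noteq> range (\<lambda>n::int. x [^] n)"
    using ncyc cyclic_group x by blast
  then obtain y where y: "y \<in> carrier G" "\<And>n::int. y \<noteq> x [^] n"
    using x by blast
  have y1: "y \<noteq> \<one>"
    using y(2)[of 0] by simp
  have ox: "ord x = p" and oy: "ord y = p"
    using ord_eq x y(1) y1 by auto
  let ?P = "integer_mod_group p \<times>\<times> integer_mod_group p"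
  define f where "f = (\<lambda>(i::int, j::int). x [^] i \<otimes> y [^] j)"
  have car: "carrier ?P = {0..<int p} \<times> {0..<int p}"
    using p0 by (simp add: carrier_integer_mod_group)
  \<comment> \<open>Addition in \<open>integer_mod_group p\<close> reduces mod \<open>p\<close>;
    powers of \<open>x\<close> and \<open>y\<close> do not notice this, since both elements have
    order \<open>p\<close>.\<close>
  have mod_x: "x [^] (k mod int p) = x [^] k" and mod_y: "y [^] (k mod int p) = y [^] k" for k :: int
    using int_pow_eq[OF x(1)] int_pow_eq[OF y(1)] ox oy by (simp_all add: minus_mod_eq_mult_div)
  have hom: "f \<in> hom ?P G"
  proof (rule homI)
    show "f u \<in> carrier G" for u
      using x y by (auto simp: f_def split: prod.split)
    show "f (u \<otimes>\<^bsub>?P\<^esub> v) = f u \<otimes> f v" for u v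
      using x y by (auto simp: f_def mod_x mod_y int_pow_mult m_ac split: prod.split)
  qed
  have small: "i = j" if "int p dvd i - j" "i \<in> {0..<int p}" "j \<in> {0..<int p}" for i j
    using that by (metis atLeastLessThan_iff mod_eq_dvd_iff mod_pos_pos_trivial)
  have inj: "inj_on f (carrier ?P)"
  proof (rule inj_onI, unfold car, clarify)
    fix i j i' j'
    assume ij: "i \<in> {0..<int p}" "j \<in> {0..<int p}" "i' \<in> {0..<int p}" "j' \<in> {0..<int p}"
      and "f (i, j) = f (i', j')"
    then have eq: "x [^] i \<otimes> y [^] j = x [^] i' \<otimes> y [^] j'"
      by (simp add: f_def)
    have pw: "y [^] (j' - j) = x [^] (i - i')"
    proof -
      have "x [^] i' \<otimes> y [^] j \<otimes> y [^] (j' - j) = x [^] i' \<otimes> y [^] j'"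
        using x y by (simp add: m_assoc flip: int_pow_mult)
      also have "\<dots> = x [^] i' \<otimes> y [^] j \<otimes> x [^] (i - i')"
      proof -
        have "x [^] i = x [^] i' \<otimes> x [^] (i - i')"
          using x by (simp flip: int_pow_mult)
        then show ?thesis
          using x y by (simp add: eq[symmetric] m_ac)
      qed
      finally show ?thesis
        using x y by (subst (asm) Units_l_cancel) auto
    qed
    \<comment> \<open>Otherwise j' - j has an inverse u mod \<open>p\<close>, and raising
      \<open>pw\<close> to the power u exhibits \<open>y\<close> as a power of
      \<open>x\<close>.\<close>
    have "int p dvd j' - j"
    proof (rule ccontr)
      assume "\<not> int p dvd j' - j"
      then have "coprime (j' - j) (int p)"
        using p by (simp add: prime_imp_coprime coprime_commute)
      then obtain u where u: "[(j' - j) * u = 1] (mod int p)"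
        using cong_solve_coprime_int by blast
      have "y [^] ((j' - j) * u) = y [^] (1::int)"
        using int_pow_eq[OF y(1)] oy u by (metis cong_iff_dvd_diff cong_sym)
      then have "y = x [^] ((i - i') * u)"
        using x y pw by (metis int_pow_1 int_pow_pow)
      then show False
        using y(2) by blast
    qed
    then have j: "j' = j"
      using small ij by blast
    then have "x [^] i = x [^] i'"
      using eq x y by simp
    then have "int p dvd i' - i"
      using int_pow_eq[OF x(1)] ox by blast
    then have "i' = i"
      using small ij by blast
    then show "i = i' \<and> j = j'"
      using j by simp
  qed
  \<comment> \<open>Surjectivity comes from counting: both sides have p^2 elements.\<close>
  have "card (f ` carrier ?P) = card (carrier G)"
    using card_image[OF inj] ord_G unfolding car by (simp add: order_def power2_eq_square)
  moreover have "f ` carrier ?P \<subseteq> carrier G"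
    using hom by (auto simp: hom_def)
  ultimately have "f ` carrier ?P = carrier G"
    using fin by (metis card_subset_eq)
  then have "?P \<cong> G"
    using hom inj by (auto simp: is_iso_def iso_def bij_betw_def)
  then show ?thesis
    by (rule group.iso_sym[rotated]) (intro DirProd_group group_integer_mod_group)
qed

section \<open>Indices of subrings and centralizers, and the count of commuting pairs\<close>

lemma card_subrng_dvd:
  fixes S :: "'a::{ring,finite} set"
  assumes "subrng S"
  shows "card S dvd card (UNIV :: 'a set)"
proof -
  interpret comm_group "add_grp (UNIV :: 'a set)" by (rule comm_group_add_grp_UNIV)
  have "subgroup S (add_grp UNIV)"
    using assms by (simp add: subrng_def)
  from lagrange[OF this] show ?thesis
    by (metis add_grp_def dvd_triv_right order_def partial_object.simps(1))
qed

lemma card_subrng_pos: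
  fixes S :: "'a::{ring,finite} set"
  assumes "subrng S"
  shows "card S > 0"
  using assms by (auto simp: subrng_def subgroup_add_grp_iff card_gt_0_iff)

text \<open>Lagrange's theorem. Since \<open>K\<close> is an arbitrary set, a singleton in its place
  yields the index of the centralizer of one element.\<close>

lemma order_Mod_rel_center:
  fixes S K :: "'a::{ring,finite} set"
  assumes "subrng S"
  shows "order (add_grp S Mod rel_center S K) * card (rel_center S K) = card S"
proof -
  interpret comm_group "add_grp S" by (rule comm_group_add_grp[OF assms])
  have "subgroup (rel_center S K) (add_grp S)"
    using rel_center_normal[OF assms] by (simp add: normal_imp_subgroup)
  from lagrange[OF this] show ?thesis
    by (simp add: order_def FactGroup_def add_grp_def)
qed

text \<open>The index of a proper centralizer has a prime factor. This factor divides |K|, hence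
  |R|, so it is at least \<open>p\<close>, and so is the index.\<close>

lemma card_centralizer_le:
  fixes K :: "'a::{ring,finite} set"
  assumes K: "subrng K" and ne: "rel_center K {s} \<noteq> K"
    and min: "\<And>q. prime q \<Longrightarrow> q dvd card (UNIV :: 'a set) \<Longrightarrow> p \<le> q"
  shows "p * card (rel_center K {s}) \<le> card K"
proof -
  let ?m = "order (add_grp K Mod rel_center K {s})"
  have m: "?m * card (rel_center K {s}) = card K"
    by (rule order_Mod_rel_center[OF K])
  have "rel_center K {s} \<subseteq> K"
    by (auto simp: rel_center_def)
  then have "?m \<noteq> 1"
    using m ne by (metis card_subset_eq finite mult_1)
  then obtain q where q: "prime q" "q dvd ?m"
    using prime_factor_nat by blast
  then have "p \<le> q"
    using min m card_subrng_dvd[OF K] by (metis dvd_mult2 dvd_trans)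
  moreover have "?m > 0"
    using m card_subrng_pos[OF K] by (metis gr0I mult_0 less_irrefl)
  then have "q \<le> ?m"
    using q dvd_imp_le by blast
  ultimately show ?thesis
    using m mult_le_mono1 le_trans by metis
qed

lemma card_commuting_pairs:
  fixes S K :: "'a::{ring,finite} set"
  shows "card {(s, k) \<in> S \<times> K. s * k = k * s} = (\<Sum>s\<in>S. card (rel_center K {s}))"
proof -
  have "{(s, k) \<in> S \<times> K. s * k = k * s} = (SIGMA s:S. rel_center K {s})"
    by (auto simp: rel_center_def)
  then show ?thesis
    by simp
qed

text \<open>Each element of Z(S,K) commutes with all of \<open>K\<close>, every other element of
  \<open>S\<close> with at most a fraction 1/p of it. The factor \<open>p\<close> on both sides
  keeps the estimate within the natural numbers.\<close>

lemma card_commuting_pairs_le: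
  fixes S K :: "'a::{ring,finite} set"
  assumes "subrng K"
    and min: "\<And>q. prime q \<Longrightarrow> q dvd card (UNIV :: 'a set) \<Longrightarrow> p \<le> q"
  shows "p * card {(s, k) \<in> S \<times> K. s * k = k * s}
    \<le> (p * card (rel_center S K) + card (S - rel_center S K)) * card K"
proof -
  let ?Z = "rel_center S K"
  have Z: "?Z \<subseteq> S"
    by (auto simp: rel_center_def)
  have "p * card {(s, k) \<in> S \<times> K. s * k = k * s}
      = (\<Sum>s\<in>?Z. p * card (rel_center K {s})) + (\<Sum>s\<in>S - ?Z. p * card (rel_center K {s}))"
    using sum.subset_diff[OF Z, of "\<lambda>s. p * card (rel_center K {s})"]
    unfolding card_commuting_pairs sum_distrib_left by simp
  also have "\<dots> \<le> (\<Sum>s\<in>?Z. p * card K) + (\<Sum>s\<in>S - ?Z. card K)"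
  proof (intro add_mono sum_mono)
    fix s
    show "p * card (rel_center K {s}) \<le> p * card K"
      by (auto intro!: card_mono simp: rel_center_def)
    assume "s \<in> S - ?Z"
    then obtain k where "k \<in> K" "s * k \<noteq> k * s"
      by (auto simp: rel_center_def)
    then have "k \<in> K - rel_center K {s}"
      by (auto simp: rel_center_def)
    then have "rel_center K {s} \<noteq> K"
      by blast
    then show "p * card (rel_center K {s}) \<le> card K"
      using card_centralizer_le assms by blast
  qed
  also have "\<dots> = (p * card ?Z + card (S - ?Z)) * card K"
    by (simp add: algebra_simps)
  finally show ?thesis .
qed

section \<open>The factor group S/Z(S,K) is not cyclic\<close>

text \<open>Ring analogue of the fact that a group with cyclic central quotient is abelian: a
  generating coset of \<open>a\<close> gives S = Z + \<int>a, and integer multiples of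
  \<open>a\<close> commute with one another.\<close>

lemma commutative_on_if_cyclic_Mod_rel_center:
  fixes S K :: "'a::ring set"
  assumes S: "subrng S" and SK: "S \<subseteq> K" and cyc: "cyclic_group (add_grp S Mod rel_center S K)"
  shows "commutative_on S"
proof -
  let ?G = "add_grp S" and ?Z = "rel_center S K"
  interpret comm_group ?G by (rule comm_group_add_grp[OF S])
  interpret Z: normal ?Z ?G by (rule rel_center_normal[OF S])
  have car: "carrier ?G = S"
    by (simp add: add_grp_def)
  obtain A where A: "A \<in> carrier (?G Mod ?Z)"
    "carrier (?G Mod ?Z) = range (\<lambda>n::int. A [^]\<^bsub>?G Mod ?Z\<^esub> n)"
    using cyc group.cyclic_group[OF Z.factorgroup_is_group] by blast
  obtain a where a: "a \<in> S" "A = ?Z #>\<^bsub>?G\<^esub> a"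
    using A(1) by (auto simp: carrier_FactGroup car)
  have decomp: "\<exists>n::int. \<exists>z\<in>?Z. s = z + a [^]\<^bsub>?G\<^esub> n" if "s \<in> S" for s
  proof -
    have "?Z #>\<^bsub>?G\<^esub> s \<in> carrier (?G Mod ?Z)"
      using that by (auto simp: carrier_FactGroup car)
    then obtain n :: int where "?Z #>\<^bsub>?G\<^esub> s = ?Z #>\<^bsub>?G\<^esub> (a [^]\<^bsub>?G\<^esub> n)"
      using A a Z.FactGroup_int_pow[of a] car by auto
    moreover have "s \<in> ?Z #>\<^bsub>?G\<^esub> s"
      using that car rcos_self Z.subgroup_axioms by blast
    ultimately show ?thesis
      by (auto simp: r_coset_def add_grp_def)
  qed
  \<comment> \<open>The centralizer of \<open>t\<close> in \<open>S\<close> is an additive subgroup.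
    It contains \<open>a\<close> by assumption and Z(S,K) because t \<in> K, hence all of
    \<open>S\<close> by \<open>decomp\<close>.\<close>
  have sub: "S \<subseteq> rel_center S {t}" if t: "t \<in> S" "t * a = a * t" for t
  proof
    fix s
    assume s: "s \<in> S"
    then obtain n :: int and z where z: "z \<in> ?Z" "s = z + a [^]\<^bsub>?G\<^esub> n"
      using decomp by blast
    have C: "subgroup (rel_center S {t}) ?G"
      using rel_center_normal[OF S] by (simp add: normal_imp_subgroup)
    have "a \<in> rel_center S {t}"
      using a t by (simp add: rel_center_def)
    then have "a [^]\<^bsub>?G\<^esub> n \<in> rel_center S {t}"
      by (rule subgroup_int_pow_closed[OF C])
    moreover have "z \<in> rel_center S {t}"
      using z t SK by (auto simp: rel_center_def)
    ultimately show "s \<in> rel_center S {t}"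
      using subgroup.m_closed[OF C] z by (simp add: add_grp_def)
  qed
  \<comment> \<open>Two rounds of \<open>sub\<close>: taking \<open>a\<close> itself for
    \<open>t\<close> shows that \<open>a\<close> commutes with all of \<open>S\<close>, which frees
    \<open>sub\<close> for every \<open>t\<close> in \<open>S\<close>.\<close>
  have "t * a = a * t" if "t \<in> S" for t
    using sub[OF a(1) refl] that by (auto simp: rel_center_def)
  then show ?thesis
    using sub by (fastforce simp: commutative_on_def rel_center_def)
qed

section \<open>Consequences of the prescribed value of Pr(S,K)\<close>

lemma card_commuting_pairs_eq_comm_prob:
  fixes S K :: "'a::{ring,finite} set"
  assumes "subrng S" "subrng K"
  shows "real (card {(s, k) \<in> S \<times> K. s * k = k * s}) = comm_prob S K * (real (card S) * real (card K))"
proof -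
  have "card S \<noteq> 0" "card K \<noteq> 0"
    using assms card_subrng_pos by fastforce+
  then show ?thesis
    unfolding comm_prob_def card_cartesian_product by simp
qed

text \<open>Let N be the number of commuting pairs. Clearing denominators gives N p^3 = (p^2 + p -
  1) |S| |K|. Modulo \<open>p\<close> this leaves p dvd |S| |K|, and both orders divide |R|.\<close>

lemma prime_dvd_card_if_comm_prob:
  fixes S K :: "'a::{ring,finite} set"
  assumes S: "subrng S" and K: "subrng K" and p: "prime (p::nat)"
    and Pr: "comm_prob S K = (real p ^ 2 + real p - 1) / real p ^ 3"
  shows "p dvd card (UNIV :: 'a set)"
proof -
  let ?N = "card {(s, k) \<in> S \<times> K. s * k = k * s}"
  have pos: "card S > 0" "card K > 0" "p > 0"
    using S K p card_subrng_pos prime_gt_0_nat by auto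
  have "real ?N * real p ^ 3 = (real p ^ 2 + real p - 1) * (real (card S) * real (card K))"
    using card_commuting_pairs_eq_comm_prob[OF S K] Pr pos by simp
  \<comment> \<open>The negative term moves to the left so that the equation transfers to natural
    numbers.\<close>
  then have "real (?N * p ^ 3 + card S * card K) = real ((p ^ 2 + p) * (card S * card K))"
    by (simp add: algebra_simps)
  then have "?N * p ^ 3 + card S * card K = (p ^ 2 + p) * (card S * card K)"
    using of_nat_eq_iff by blast
  moreover have "p dvd (p ^ 2 + p) * (card S * card K)"
    by (simp add: power2_eq_square)
  ultimately have "p dvd ?N * p ^ 3 + card S * card K"
    by (rule ssubst)
  then have "p dvd card S * card K"
    by (subst (asm) dvd_add_right_iff) (rule dvd_mult, simp)
  then have "p dvd card S \<or> p dvd card K"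
    by (rule prime_dvd_multD[OF p])
  then show ?thesis
    using card_subrng_dvd[OF S] card_subrng_dvd[OF K] by (elim disjE) (rule dvd_trans; assumption)+
qed

lemma Mod_rel_center_iso:
  fixes S K :: "'a::{ring,finite} set"
  assumes S: "subrng S" and K: "subrng K" and SK: "S \<subseteq> K" and nc: "\<not> commutative_on S"
    and p: "prime (p::nat)" and min: "\<And>q. prime q \<Longrightarrow> q dvd card (UNIV :: 'a set) \<Longrightarrow> p \<le> q"
    and Pr: "comm_prob S K = (real p ^ 2 + real p - 1) / real p ^ 3"
  shows "add_grp S Mod rel_center S K \<cong> integer_mod_group p \<times>\<times> integer_mod_group p"
proof -
  let ?Z = "rel_center S K" and ?N = "card {(s, k) \<in> S \<times> K. s * k = k * s}"
  let ?Q = "add_grp S Mod rel_center S K"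
  interpret comm_group "add_grp S" by (rule comm_group_add_grp[OF S])
  interpret Q: comm_group ?Q
    using abelian_FactGroup rel_center_normal[OF S] by (simp add: normal_imp_subgroup)
  have ind: "order ?Q * card ?Z = card S"
    by (rule order_Mod_rel_center[OF S])
  have pos: "card S > 0" "card K > 0" "p > 0"
    using S K p card_subrng_pos prime_gt_0_nat by auto
  have Zpos: "card ?Z > 0" and Qpos: "order ?Q > 0"
    using ind pos by (metis gr0I mult_0 mult_0_right less_irrefl)+
  have "?Z \<subseteq> S"
    by (auto simp: rel_center_def)
  then have Z: "real (card (S - ?Z)) = real (card S) - real (card ?Z)"
    by (simp add: card_Diff_subset card_mono of_nat_diff)
  let ?zk = "real (card ?Z) * real (card K)"
  have sz: "real (card S) = real (order ?Q) * real (card ?Z)"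
    by (metis ind of_nat_mult)
  have "real p * real ?N \<le> (real p * real (card ?Z) + (real (card S) - real (card ?Z))) * real (card K)"
    using of_nat_mono[OF card_commuting_pairs_le[OF K min, of S], where 'a=real]
    unfolding of_nat_mult of_nat_add Z .
  then have le: "real p * real ?N \<le> (real p + real (order ?Q) - 1) * ?zk"
    unfolding sz by (simp add: algebra_simps)
  have "real ?N = (real p ^ 2 + real p - 1) / real p ^ 3 * (real (card S) * real (card K))"
    using card_commuting_pairs_eq_comm_prob[OF S K] Pr by simp
  then have "real p ^ 3 * real ?N = ((real p ^ 2 + real p - 1) * real (order ?Q)) * ?zk"
    unfolding sz using pos by simp
  then have "((real p ^ 2 + real p - 1) * real (order ?Q)) * ?zk = real p ^ 2 * (real p * real ?N)"
    by (simp add: power2_eq_square power3_eq_cube)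
  also have "\<dots> \<le> real p ^ 2 * ((real p + real (order ?Q) - 1) * ?zk)"
    using le by (rule mult_left_mono) simp
  also have "\<dots> = ((real p + real (order ?Q) - 1) * real p ^ 2) * ?zk"
    by simp
  \<comment> \<open>Cancelling |Z| |K| > 0 leaves an inequality in \<open>p\<close> and n = [S : Z]
    alone. The terms n p^2 then cancel, leaving (p - 1) n \<le> (p - 1) p^2.\<close>
  finally have "(real p ^ 2 + real p - 1) * real (order ?Q) \<le> (real p + real (order ?Q) - 1) * real p ^ 2"
    by (rule mult_right_le_imp_le) (use pos Zpos in simp)
  then have "(real p - 1) * real (order ?Q) \<le> (real p - 1) * real p ^ 2"
    by (simp add: algebra_simps)
  then have "real (order ?Q) \<le> real p ^ 2"
    using prime_gt_1_nat[OF p] by simp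
  then have "order ?Q \<le> p\<^sup>2"
    by (metis of_nat_le_iff of_nat_power)
  moreover have fin: "finite (carrier ?Q)"
    using Qpos Q.order_gt_0_iff_finite by blast
  moreover have ncyc: "\<not> cyclic_group ?Q"
    using commutative_on_if_cyclic_Mod_rel_center[OF S SK] nc by blast
  \<comment> \<open>The index of Z(S,K) divides |S|, which divides |R|.\<close>
  moreover have "p \<le> q" if "prime q" "q dvd order ?Q" for q
    using that min ind card_subrng_dvd[OF S] by (metis dvd_mult2 dvd_trans)
  ultimately have "order ?Q = p\<^sup>2"
    using Q.order_eq_square_if_not_cyclic by blast
  then show ?thesis
    using Q.iso_integer_mod_group_square p ncyc by blast
qed

theorem theorem3p14:
  fixes S K :: "'a::{ring,finite} set"
  assumes "\<not> commutative_on (UNIV :: 'a set)"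
    and "subrng S" and "subrng K" and "S \<subseteq> K"
    and "\<not> commutative_on S" and "\<not> commutative_on K"
  shows "(\<forall>p::nat. prime p \<longrightarrow> comm_prob S K = (real p ^ 2 + real p - 1) / real p ^ 3 \<longrightarrow>
            p dvd card (UNIV :: 'a set) \<and>
            (p = (LEAST q. prime q \<and> q dvd card (UNIV :: 'a set)) \<longrightarrow>
              add_grp S Mod rel_center S K \<cong> integer_mod_group p \<times>\<times> integer_mod_group p)) \<and>
         (comm_prob S K = 5 / 8 \<longrightarrow>
            add_grp S Mod rel_center S K \<cong> integer_mod_group 2 \<times>\<times> integer_mod_group 2)"
proof -
  have "p dvd card (UNIV :: 'a set)"
    if "prime p" "comm_prob S K = (real p ^ 2 + real p - 1) / real p ^ 3" for p :: nat
    by (rule prime_dvd_card_if_comm_prob) fact+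
  moreover have "add_grp S Mod rel_center S K \<cong> integer_mod_group p \<times>\<times> integer_mod_group p"
    if "prime p" "comm_prob S K = (real p ^ 2 + real p - 1) / real p ^ 3"
      and p: "p = (LEAST q. prime q \<and> q dvd card (UNIV :: 'a set))" for p :: nat
  proof (rule Mod_rel_center_iso)
    show "p \<le> q" if "prime q" "q dvd card (UNIV :: 'a set)" for q
      unfolding p by (rule Least_le) (use that in simp)
  qed fact+
  moreover have "add_grp S Mod rel_center S K \<cong> integer_mod_group 2 \<times>\<times> integer_mod_group 2"
    if "comm_prob S K = 5 / 8"
    \<comment> \<open>For p = 2 the prescribed value is (4 + 2 - 1) / 8 = 5 / 8, and minimality is
      automatic because every prime is at least 2.\<close>
    using Mod_rel_center_iso[of S K 2] assms that by (simp add: prime_ge_2_nat)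
  ultimately show ?thesis
    by blast
qed

end
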